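(* Let $E_1\subset\mathbb{R}^n$, $n\ge 3$, be a solid ellipsoid with center at the origin $O$. Then the set of balls which are contained in $E_1$, do not contain $O$, and are suitable for $E_1$ is non-empty.
   Context: Balls are closed Euclidean balls of positive radius. Let $K$ be a convex body symmetric about the origin $O$ and $B\subset\operatorname{int}K$ a ball with $O\notin B$. Put $G:=\operatorname{conv}[B\cup(-B)]$. The ball $B$ is suitable for $K$ if for every support hyperplane $\Gamma$ of $G$ one has $B\subset\operatorname{conv}(K_\Gamma\cup K_{-\Gamma})$, where $K_\Gamma:=\Gamma\cap K$ and $K_{-\Gamma}:=(-\Gamma)\cap K$. *)

theory Defs
  imports "HOL-Analysis.Analysis"
begin

definition is_ball :: "'a::euclidean_space set \<Rightarrow> bool" where
  "is_ball B \<longleftrightarrow> (\<exists>c r. 0 < r \<and> B = cball c r)"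

definition convex_body :: "'a::euclidean_space set \<Rightarrow> bool" where
  "convex_body K \<longleftrightarrow> convex K \<and> compact K \<and> interior K \<noteq> {}"

(* Nondegenerate: injectivity of the linear map excludes flat ellipsoids. *)
definition solid_ellipsoid :: "'a::euclidean_space \<Rightarrow> 'a set \<Rightarrow> bool" where
  "solid_ellipsoid c E \<longleftrightarrow>
     (\<exists>f::'a \<Rightarrow> 'a. linear f \<and> inj f \<and> E = (\<lambda>x. c + f x) ` cball 0 1)"

(* The sign of (a, b) is free, so one inequality covers both sides of the hyperplane. *)
definition support_hyperplane :: "'a::euclidean_space set \<Rightarrow> 'a set \<Rightarrow> bool" where
  "support_hyperplane \<Gamma> G \<longleftrightarrow>
     (\<exists>a b. a \<noteq> 0 \<and> \<Gamma> = {x. a \<bullet> x = b} \<and> (\<forall>x\<in>G. a \<bullet> x \<le> b) \<and> \<Gamma> \<inter> G \<noteq> {})"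

(* The standing assumptions on K and B under which suitability is considered
   are part of the definition. *)
definition suitable :: "'a::euclidean_space set \<Rightarrow> 'a set \<Rightarrow> bool" where
  "suitable K B \<longleftrightarrow>
     convex_body K \<and> uminus ` K = K \<and>
     is_ball B \<and> B \<subseteq> interior K \<and> 0 \<notin> B \<and>
     (\<forall>\<Gamma>. support_hyperplane \<Gamma> (convex hull (B \<union> uminus ` B)) \<longrightarrow>
        B \<subseteq> convex hull ((\<Gamma> \<inter> K) \<union> ((uminus ` \<Gamma>) \<inter> K)))"

end

(* Idea: if cball 0 m is contained in K, then every ball B inside cball 0 (m/3) that misses the
   origin is suitable.  A support hyperplane {x. a \<bullet> x = b} of conv (B \<union> -B) lies within m/3 of
   the origin, so moving a point x of B along a until it meets the hyperplane, respectively its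
   reflection, covers a distance of at most 2m/3.  Both end points stay in cball 0 m, hence in K,
   and x lies between them. *)
theory Submission
  imports Defs
begin

lemma small_ball_suitable:
  fixes K B :: "'a::euclidean_space set"
  assumes K: "convex_body K" "uminus ` K = K" and mK: "cball 0 m \<subseteq> K" and "0 < m"
    and B: "is_ball B" "0 \<notin> B" and BK: "B \<subseteq> cball 0 (m/3)"
  shows "suitable K B"
  unfolding suitable_def
proof (intro conjI allI impI)
  show "B \<subseteq> interior K"
  proof -
    have "cball 0 (m/3) \<subseteq> ball (0::'a) m"
      using \<open>0 < m\<close> by auto
    moreover have "ball 0 m \<subseteq> K"
      using mK ball_subset_cball by blast
    ultimately show ?thesis
      using BK interior_maximal[OF _ open_ball] by blast
  qed
next
  fix \<Gamma>
  let ?G = "convex hull (B \<union> uminus ` B)"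
  let ?C = "convex hull ((\<Gamma> \<inter> K) \<union> ((uminus ` \<Gamma>) \<inter> K))"
  assume "support_hyperplane \<Gamma> ?G"
  then obtain a b g where "a \<noteq> 0" and \<Gamma>: "\<Gamma> = {x. a \<bullet> x = b}"
    and le: "\<And>x. x \<in> ?G \<Longrightarrow> a \<bullet> x \<le> b" and g: "g \<in> ?G" "a \<bullet> g = b"
    unfolding support_hyperplane_def by blast
  \<comment> \<open>The centered ball is convex and symmetric, so it absorbs the hull. The contact
    point \<open>g\<close> then turns the bound on \<open>norm g\<close> into a bound on the offset
    \<open>b\<close>.\<close>
  have "?G \<subseteq> cball 0 (m/3)"
    using BK by (intro hull_minimal) auto
  with g have "norm g \<le> m/3"
    by auto
  have b: "\<bar>b\<bar> \<le> norm a * (m/3)"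
    using Cauchy_Schwarz_ineq2[of a g] g \<open>norm g \<le> m/3\<close>
    by (meson mult_left_mono norm_ge_zero order_trans)
  show "B \<subseteq> ?C"
  proof
    fix x assume "x \<in> B"
    then have nx: "norm x \<le> m/3"
      using BK by auto
    \<comment> \<open>Testing the support inequality at both \<open>x\<close> and \<open>- x\<close>
      puts \<open>x\<close> in the slab between the hyperplane and its reflection.\<close>
    have "x \<in> ?G" "- x \<in> ?G"
      using \<open>x \<in> B\<close> by (auto intro: hull_inc)
    then have ax: "a \<bullet> x \<le> b" "- (a \<bullet> x) \<le> b"
      using le[of x] le[of "- x"] by auto
    \<comment> \<open>Orthogonal projection of \<open>x\<close> onto the hyperplane of all y with
      \<open>a \<bullet> y = t\<close>; the values t = b and t = -b give the two end points.\<close>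
    define p where "p t = x + ((t - a \<bullet> x) / (a \<bullet> a)) *\<^sub>R a" for t
    have ap: "a \<bullet> p t = t" for t
      using \<open>a \<noteq> 0\<close> by (simp add: p_def inner_add_right)
    \<comment> \<open>The condition on \<open>t\<close> treats both end points at once. The
      displacement is at most 2m/3 and \<open>norm x\<close> at most m/3, which add up to exactly
      m.\<close>
    have pK: "p t \<in> K" if "\<bar>t\<bar> = b" for t
    proof -
      have "\<bar>t - a \<bullet> x\<bar> \<le> 2 * b"
        using ax that by linarith
      also have "\<dots> \<le> 2 * (norm a * (m/3))"
        using b by linarith
      finally have "\<bar>t - a \<bullet> x\<bar> / norm a \<le> 2 * (m/3)"
        using \<open>a \<noteq> 0\<close> by (simp add: field_simps)
      moreover have "norm (((t - a \<bullet> x) / (a \<bullet> a)) *\<^sub>R a) = \<bar>t - a \<bullet> x\<bar> / norm a"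
        using \<open>a \<noteq> 0\<close> by (simp add: dot_square_norm power2_eq_square)
      ultimately have "norm (p t) \<le> m"
        unfolding p_def using nx norm_triangle_ineq[of x "((t - a \<bullet> x) / (a \<bullet> a)) *\<^sub>R a"]
        by linarith
      then show ?thesis
        using mK by auto
    qed
    have "b \<ge> 0"
      using ax by linarith
    have "p b \<in> \<Gamma> \<inter> K"
      using ap pK \<open>b \<ge> 0\<close> by (auto simp: \<Gamma>)
    moreover have "p (- b) \<in> uminus ` \<Gamma> \<inter> K"
      using ap[of "- b"] pK[of "- b"] \<open>b \<ge> 0\<close>
      by (auto simp: \<Gamma> intro!: image_eqI[where x = "- p (- b)"])
    ultimately have pC: "p b \<in> ?C" "p (- b) \<in> ?C"
      by (auto intro: hull_inc)
    show "x \<in> ?C"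
    \<comment> \<open>The weights used below have denominator \<open>2 * b\<close>. If b = 0, the
      slab degenerates to a hyperplane containing \<open>x\<close>, so \<open>x\<close> is its own
      projection.\<close>
    proof (cases "b = 0")
      case True
      then have "p b = x"
        using ax by (simp add: p_def)
      then show ?thesis
        using pC by simp
    next
      case False
      \<comment> \<open>The weights are the barycentric coordinates of \<open>a \<bullet> x\<close>
        in the interval from -b to b, so the displacements along \<open>a\<close> cancel in the
        combination.\<close>
      define u where "u = (b + a \<bullet> x) / (2 * b)"
      define v where "v = (b - a \<bullet> x) / (2 * b)"
      have uv: "0 \<le> u" "0 \<le> v" "u + v = 1"
        using ax \<open>b \<ge> 0\<close> False by (auto simp: u_def v_def field_simps)
      have "u * (b - a \<bullet> x) + v * (- b - a \<bullet> x) = 0"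
        using False by (simp add: u_def v_def field_simps)
      then have "u * ((b - a \<bullet> x) / (a \<bullet> a)) + v * ((- b - a \<bullet> x) / (a \<bullet> a)) = 0"
        by (metis add_divide_distrib div_0 times_divide_eq_right)
      moreover have "u *\<^sub>R p b + v *\<^sub>R p (- b) = (u + v) *\<^sub>R x +
          (u * ((b - a \<bullet> x) / (a \<bullet> a)) + v * ((- b - a \<bullet> x) / (a \<bullet> a))) *\<^sub>R a"
        unfolding p_def by (simp only: scaleR_add_right scaleR_add_left scaleR_scaleR add_ac)
      ultimately have "u *\<^sub>R p b + v *\<^sub>R p (- b) = x"
        using uv by simp
      then show ?thesis
        using convexD[OF convex_convex_hull pC uv] by simp
    qed
  qed
qed (use assms in auto)

text \<open>An injective linear endomorphism in finite dimension is surjective, hence an open map,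
  so the image of the open unit ball is an open neighborhood of the origin.\<close>

lemma solid_ellipsoid_zero_interior:
  fixes E :: "'a::euclidean_space set"
  assumes "solid_ellipsoid 0 E"
  shows "0 \<in> interior E"
proof -
  obtain f :: "'a \<Rightarrow> 'a" where f: "linear f" "inj f" and E: "E = f ` cball 0 1"
    using assms unfolding solid_ellipsoid_def by auto
  have "open (f ` ball 0 1)"
    using f linear_injective_imp_surjective open_surjective_linear_image by blast
  moreover have "0 \<in> f ` ball 0 1"
    using linear_0[OF f(1)] by (force intro: image_eqI[where x = 0])
  ultimately show ?thesis
    unfolding E by (meson ball_subset_cball image_mono interiorI)
qed

lemma solid_ellipsoid_convex_body:
  fixes E :: "'a::euclidean_space set"
  assumes "solid_ellipsoid 0 E"
  shows "convex_body E"
proof -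
  obtain f :: "'a \<Rightarrow> 'a" where f: "linear f" and E: "E = f ` cball 0 1"
    using assms unfolding solid_ellipsoid_def by auto
  have "compact E"
    unfolding E by (intro compact_continuous_image linear_continuous_on linear_linear[THEN iffD2] f compact_cball)
  then show ?thesis
    unfolding convex_body_def using solid_ellipsoid_zero_interior[OF assms] f
    by (auto simp: E intro: convex_linear_image)
qed

lemma solid_ellipsoid_symmetric:
  fixes E :: "'a::euclidean_space set"
  assumes "solid_ellipsoid 0 E"
  shows "uminus ` E = E"
proof -
  obtain f :: "'a \<Rightarrow> 'a" where f: "linear f" and E: "E = f ` cball 0 1"
    using assms unfolding solid_ellipsoid_def by auto
  have "uminus ` E = f ` uminus ` cball 0 1"
    unfolding E image_image by (simp add: linear_neg[OF f])
  also have "uminus ` cball (0::'a) 1 = cball 0 1"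
    by (force intro: image_eqI[where x = "- _"])
  finally show ?thesis
    unfolding E .
qed

theorem mainTheorem2:
  fixes E\<^sub>1 :: "(real ^ 'n) set"
  assumes "CARD('n) \<ge> 3"
    and "solid_ellipsoid 0 E\<^sub>1"
  shows "{B. is_ball B \<and> B \<subseteq> E\<^sub>1 \<and> 0 \<notin> B \<and> suitable E\<^sub>1 B} \<noteq> {}"
proof -
  obtain m where m: "0 < m" "cball 0 m \<subseteq> E\<^sub>1"
    using solid_ellipsoid_zero_interior[OF assms(2)] by (meson mem_interior_cball)
  \<comment> \<open>With center at distance m/6 and radius m/12, the ball misses the origin since
    m/12 < m/6, and it stays within m/6 + m/12 = m/4 < m/3 of it.\<close>
  obtain c :: "real ^ 'n" where c: "norm c = m/6"
    using vector_choose_size[of "m/6"] m by auto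
  define B where "B = cball c (m/12)"
  have "0 < m/12"
    using m by simp
  then have B: "is_ball B" "0 \<notin> B"
    unfolding is_ball_def B_def using c by (blast, simp)
  have "B \<subseteq> cball 0 (m/3)"
    using m c by (simp add: B_def cball_subset_cball_iff)
  then have "suitable E\<^sub>1 B"
    using small_ball_suitable[OF solid_ellipsoid_convex_body solid_ellipsoid_symmetric] assms(2) m B
    by metis
  moreover have "B \<subseteq> E\<^sub>1"
    using calculation interior_subset unfolding suitable_def by blast
  ultimately show ?thesis
    using B by auto
qed

end
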